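(* Let $n,k,d$ be non-negative integers with $k\geq 1$, let $G$ be an $(n,k,d)$-graph, and let $uv\in E(G)$ be an edge such that $\max\{d_G(u),d_G(v)\}\geq 2k$. Then $G-uv$ is not an $(n,k-1,d)$-graph if and only if there exists a vertex subset $S\subseteq V(G)$ with $|S|=n-2+2k$ such that $G[S]$ contains a $(k-1)$-matching and $G-S$ is the disjoint union of $d$ odd components, each of which is factor-critical, together with one further component consisting of the single edge $uv$.
   Context: All graphs are finite, undirected and simple; $d_G(u)$ is the degree of $u$ in $G$. $G[S]$ is the subgraph induced by $S$ and $G-S$ is the subgraph induced by $V(G)\setminus S$. A $k$-matching is a matching with exactly $k$ edges. For a non-negative integer $d$, a defect-$d$ matching of a graph $H$ is a matching covering exactly $|V(H)|-d$ vertices of $H$. A matching $M$ extends to a matching $M'$ if $M\subseteq M'$. A graph is factor-critical if deleting any one of its vertices leaves a graph with a perfect matching (a single vertex is factor-critical). Let $n,k,d$ be non-negative integers. A graph $G$ is an $(n,k,d)$-graph if $|V(G)|\geq n+2k+d+2$, $|V(G)|-n-d$ is even, and for every set $S$ of $n$ vertices of $G$, the graph $H=G-S$ contains a $k$-matching and every $k$-matching of $H$ can be extended to a defect-$d$ matching of $H$. *)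

theory Defs
  imports Main
begin

record 'a graph =
  verts :: "'a set"
  edges :: "'a set set"

definition simple_graph :: "'a graph \<Rightarrow> bool" where
  "simple_graph G \<longleftrightarrow> finite (verts G) \<and> (\<forall>e\<in>edges G. e \<subseteq> verts G \<and> card e = 2)"

definition degree :: "'a graph \<Rightarrow> 'a \<Rightarrow> nat" where
  "degree G u = card {e \<in> edges G. u \<in> e}"

definition induced_subgraph :: "'a graph \<Rightarrow> 'a set \<Rightarrow> 'a graph" where
  "induced_subgraph G S = \<lparr>verts = verts G \<inter> S, edges = {e \<in> edges G. e \<subseteq> S}\<rparr>"

definition delete_verts :: "'a graph \<Rightarrow> 'a set \<Rightarrow> 'a graph" where
  "delete_verts G S = induced_subgraph G (verts G - S)"

definition delete_edge :: "'a graph \<Rightarrow> 'a set \<Rightarrow> 'a graph" where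
  "delete_edge G e = \<lparr>verts = verts G, edges = edges G - {e}\<rparr>"

definition matching :: "'a graph \<Rightarrow> 'a set set \<Rightarrow> bool" where
  "matching G M \<longleftrightarrow> M \<subseteq> edges G \<and> (\<forall>e\<in>M. \<forall>f\<in>M. e \<noteq> f \<longrightarrow> e \<inter> f = {})"

definition k_matching :: "nat \<Rightarrow> 'a graph \<Rightarrow> 'a set set \<Rightarrow> bool" where
  "k_matching k G M \<longleftrightarrow> matching G M \<and> card M = k"

definition perfect_matching :: "'a graph \<Rightarrow> 'a set set \<Rightarrow> bool" where
  "perfect_matching G M \<longleftrightarrow> matching G M \<and> \<Union>M = verts G"

text \<open>Stated additively, so that no defect-\<open>d\<close> matching exists when \<open>d\<close> exceeds the number
  of vertices (truncated subtraction would admit the empty matching).\<close>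

definition defect_matching :: "nat \<Rightarrow> 'a graph \<Rightarrow> 'a set set \<Rightarrow> bool" where
  "defect_matching d G M \<longleftrightarrow> matching G M \<and> card (\<Union>M) + d = card (verts G)"

definition factor_critical :: "'a graph \<Rightarrow> bool" where
  "factor_critical G \<longleftrightarrow> (\<forall>v\<in>verts G. \<exists>M. perfect_matching (delete_verts G {v}) M)"

definition nkd_graph :: "nat \<Rightarrow> nat \<Rightarrow> nat \<Rightarrow> 'a graph \<Rightarrow> bool" where
  "nkd_graph n k d G \<longleftrightarrow>
     card (verts G) \<ge> n + 2 * k + d + 2 \<and>
     even (int (card (verts G)) - int n - int d) \<and>
     (\<forall>S. S \<subseteq> verts G \<and> card S = n \<longrightarrow>
        (\<exists>M. k_matching k (delete_verts G S) M) \<and>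
        (\<forall>M. k_matching k (delete_verts G S) M \<longrightarrow>
           (\<exists>M'. defect_matching d (delete_verts G S) M' \<and> M \<subseteq> M')))"

definition reachable :: "'a graph \<Rightarrow> ('a \<times> 'a) set" where
  "reachable G = {(x, y). x \<in> verts G \<and> y \<in> verts G \<and> (x, y) \<in> {(a, b). {a, b} \<in> edges G}\<^sup>*}"

text \<open>The components are taken as subgraphs, not as vertex sets.\<close>

definition components :: "'a graph \<Rightarrow> 'a graph set" where
  "components G = induced_subgraph G ` (verts G // reachable G)"

definition single_edge :: "'a \<Rightarrow> 'a \<Rightarrow> 'a graph" where
  "single_edge u v = \<lparr>verts = {u, v}, edges = {{u, v}}\<rparr>"

end

theory Submission
  imports Defs
begin

text \<open>Write k = m + 1. For a set S as described, let M be an m-matching of G[S] and delete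
  from G the n vertices of S that M misses. An extension of M can only add edges of G - S. Without
  uv it misses u, v and a vertex of every odd component, hence d + 2 vertices, so it does not have
  defect d (\<open>not_nkd_graph_delete_edge\<close>).

  Conversely, let M be an m-matching of G - uv - S0, with n vertices in S0, that has no defect-d
  extension. G is also an (n,m,d)-graph (\<open>nkd_graph_Suc_imp\<close>, through
  \<open>matching_exchange\<close>), so M extends in G, but only by using uv. The same holds for
  (m+1)-matchings containing M, which forces uv to be a component of G - S, where S is S0 together
  with V(M). Let Q be the rest of G - S. Every matching of Q misses at least d vertices, since
  otherwise M would extend without uv. By the degree condition u (or, by symmetry, v) has a
  neighbour in S0; matching it frees one place in the deleted set, which any vertex y of Q may take,
  and this yields a matching of Q with defect d that misses y. So each vertex of Q is missed by some
  maximum matching. Gallai's lemma (\<open>never_both_missed_trans\<close>) then makes every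
  component of Q factor-critical, with exactly one vertex missed by each maximum matching; thus
  there are d of them (\<open>nkd_graph_delete_edge_witness\<close>).\<close>

section \<open>Graphs, deletions and matchings\<close>

lemma simple_graph_edgeD:
  assumes "simple_graph G" "e \<in> edges G"
  shows "e \<subseteq> verts G" "card e = 2" "finite e"
  using assms by (auto simp: simple_graph_def card_ge_0_finite)

lemma simple_graph_finite:
  assumes "simple_graph G"
  shows "finite (verts G)" "finite (edges G)"
proof -
  show fin: "finite (verts G)" using assms by (simp add: simple_graph_def)
  have "edges G \<subseteq> Pow (verts G)" using assms by (auto simp: simple_graph_def)
  then show "finite (edges G)" using fin by (simp add: finite_subset)
qed

lemma simple_graph_edge_other_end:
  assumes "simple_graph G" "e \<in> edges G" "x \<in> e"
  obtains y where "e = {x, y}" "y \<noteq> x" "y \<in> verts G"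
proof -
  obtain a b where "e = {a, b}" "a \<noteq> b"
    using simple_graph_edgeD(2)[OF assms(1,2)] by (auto simp: card_2_iff)
  then show thesis
    using that assms(3) simple_graph_edgeD(1)[OF assms(1,2)] by (auto simp: insert_commute)
qed

lemma verts_delete_verts [simp]: "verts (delete_verts G S) = verts G - S"
  by (auto simp: delete_verts_def induced_subgraph_def)

lemma edges_delete_verts [simp]:
  "edges (delete_verts G S) = {e \<in> edges G. e \<subseteq> verts G - S}"
  by (simp add: delete_verts_def induced_subgraph_def)

lemma simple_graph_delete_verts: "simple_graph G \<Longrightarrow> simple_graph (delete_verts G S)"
  by (simp add: simple_graph_def)

lemma verts_delete_edge [simp]: "verts (delete_edge G e) = verts G"
  and edges_delete_edge [simp]: "edges (delete_edge G e) = edges G - {e}"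
  by (simp_all add: delete_edge_def)

lemma simple_graph_delete_edge: "simple_graph G \<Longrightarrow> simple_graph (delete_edge G e)"
  by (simp add: simple_graph_def)

text \<open>Turns matchings of different subgraphs into matchings of the one graph \<open>G\<close>,
  where they can be joined and compared.\<close>

lemma matching_delete_verts_iff:
  assumes "simple_graph G"
  shows "matching (delete_verts G S) M \<longleftrightarrow> matching G M \<and> \<Union>M \<inter> S = {}"
  using simple_graph_edgeD(1)[OF assms] by (fastforce simp: matching_def)

lemma matching_delete_edge_iff: "matching (delete_edge G e) M \<longleftrightarrow> matching G M \<and> e \<notin> M"
  by (auto simp: matching_def)

lemma matching_subset: "matching G M \<Longrightarrow> N \<subseteq> M \<Longrightarrow> matching G N"
  unfolding matching_def by blast

lemma matching_Un:
  "matching G M \<Longrightarrow> matching G N \<Longrightarrow> \<Union>M \<inter> \<Union>N = {} \<Longrightarrow> matching G (M \<union> N)"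
  unfolding matching_def by (simp add: ball_Un) blast

lemma matching_insert:
  "matching G M \<Longrightarrow> e \<in> edges G \<Longrightarrow> e \<inter> \<Union>M = {} \<Longrightarrow> matching G (insert e M)"
  unfolding matching_def by (simp add: Int_commute) blast

lemma matching_unique_edge:
  "matching G M \<Longrightarrow> e \<in> M \<Longrightarrow> f \<in> M \<Longrightarrow> x \<in> e \<Longrightarrow> x \<in> f \<Longrightarrow> e = f"
  by (auto simp: matching_def)

lemma matching_Diff_disjoint:
  "matching G M \<Longrightarrow> N \<subseteq> M \<Longrightarrow> \<Union>(M - N) \<inter> \<Union>N = {}"
  by (fastforce simp: matching_def)

lemma matching_finite: "simple_graph G \<Longrightarrow> matching G M \<Longrightarrow> finite M"
  using simple_graph_finite(2) finite_subset by (auto simp: matching_def)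

lemma matching_Union_subset: "simple_graph G \<Longrightarrow> matching G M \<Longrightarrow> \<Union>M \<subseteq> verts G"
  using simple_graph_edgeD(1) by (fastforce simp: matching_def)

lemma matching_card_Union:
  assumes "simple_graph G" "matching G M"
  shows "card (\<Union>M) = 2 * card M"
proof -
  have "card (\<Union>M) = sum card M"
  proof (rule card_Union_disjoint)
    show "pairwise disjnt M" using assms(2) by (auto simp: matching_def pairwise_def disjnt_def)
  qed (use assms simple_graph_edgeD(3) in \<open>auto simp: matching_def\<close>)
  also have "\<dots> = sum (\<lambda>_. 2) M"
    by (rule sum.cong) (use assms simple_graph_edgeD(2) in \<open>auto simp: matching_def\<close>)
  finally show ?thesis by simp
qed

section \<open>Exchange of matchings and descent from k + 1 to k\<close>

lemma card_insert_edge: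
  assumes "finite M" "e \<inter> \<Union>M = {}" "x \<in> e"
  shows "card (insert e M) = Suc (card M)"
  using assms by (subst card_insert_disjoint) auto

text \<open>The inductive step removes a vertex \<open>x\<close> covered only by \<open>N\<close> with its \<open>N\<close>-neighbour \<open>y\<close>
  and then re-inserts either the \<open>N\<close>-edge \<open>xy\<close> or the \<open>M\<close>-edge \<open>yz\<close>, whichever keeps \<open>z\<close>
  covered; this replaces the usual augmenting path.\<close>

lemma matching_exchange:
  assumes "simple_graph G" "matching G M" "matching G N" "card M < card N"
  shows "\<exists>M'. matching G M' \<and> M' \<subseteq> M \<union> N \<and> card M' = Suc (card M) \<and> \<Union>M \<subseteq> \<Union>M'"
  using assms(2-4)
proof (induction "card M" arbitrary: M N rule: less_induct)
  case less
  note G = assms(1)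
  note M = less.prems(1) and N = less.prems(2)
  have finM: "finite M" and finN: "finite N" using matching_finite[OF G] M N by auto
  have "finite (\<Union>M)" using matching_Union_subset[OF G M] simple_graph_finite(1)[OF G] finite_subset by blast
  moreover have "card (\<Union>M) < card (\<Union>N)"
    using matching_card_Union[OF G] M N less.prems(3) by simp
  ultimately have "\<not> \<Union>N \<subseteq> \<Union>M" by (meson card_mono leD)
  then obtain x f where f: "f \<in> N" "x \<in> f" and xM: "x \<notin> \<Union>M" by blast
  have fE: "f \<in> edges G" using f N by (auto simp: matching_def)
  obtain y where y: "f = {x, y}" "y \<noteq> x" using simple_graph_edge_other_end[OF G fE f(2)] by metis
  show ?case
  proof (cases "y \<in> \<Union>M")
    case False
    then have dj: "f \<inter> \<Union>M = {}" using xM y by auto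
    show ?thesis
      using matching_insert[OF M fE dj] card_insert_edge[OF finM dj f(2)] f(1)
      by (intro exI[of _ "insert f M"]) auto
  next
    case True
    then obtain g where g: "g \<in> M" "y \<in> g" by blast
    have gE: "g \<in> edges G" using g M by (auto simp: matching_def)
    obtain z where z: "g = {y, z}" "z \<noteq> y" using simple_graph_edge_other_end[OF G gE g(2)] by metis
    have cM: "card (M - {g}) < card M" "Suc (card (M - {g})) = card M"
      using card_Diff1_less[OF finM g(1)] card_Suc_Diff1[OF finM g(1)] by simp_all
    have cN: "Suc (card (N - {f})) = card N" using card_Suc_Diff1[OF finN f(1)] .
    have "card (M - {g}) < card (N - {f})" using cM cN less.prems(3) by simp
    then obtain M0 where M0: "matching G M0" "M0 \<subseteq> (M - {g}) \<union> (N - {f})"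
      "card M0 = Suc (card (M - {g}))" "\<Union>(M - {g}) \<subseteq> \<Union>M0"
      using less.hyps[OF cM(1) matching_subset[OF M] matching_subset[OF N], of "N - {f}"] by auto
    have fin0: "finite M0" using matching_finite[OF G M0(1)] .
    have "\<Union>(N - {f}) \<inter> f = {}" using matching_Diff_disjoint[OF N, of "{f}"] f by simp
    moreover have "\<Union>(M - {g}) \<inter> g = {}" using matching_Diff_disjoint[OF M, of "{g}"] g by simp
    \<comment> \<open>No edge of \<open>M\<close> is at x, the only edge of \<open>M\<close> at y is
      \<open>g\<close>, and the only edge of \<open>N\<close> at x or y is \<open>f\<close>; both
      edges were taken out.\<close>
    ultimately have xy: "x \<notin> \<Union>M0" "y \<notin> \<Union>M0" using M0(2) xM y z by blast+
    have UM: "\<Union>M = \<Union>(M - {g}) \<union> {y, z}" using g z by auto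
    show ?thesis
    proof (cases "z \<in> \<Union>M0")
      case True
      then have dj: "f \<inter> \<Union>M0 = {}" using xy y by auto
      show ?thesis
        using matching_insert[OF M0(1) fE dj] card_insert_edge[OF fin0 dj f(2)] f(1) M0 cM True UM y
        by (intro exI[of _ "insert f M0"]) auto
    next
      case False
      then have dj: "g \<inter> \<Union>M0 = {}" using xy z by auto
      show ?thesis
        using matching_insert[OF M0(1) gE dj] card_insert_edge[OF fin0 dj g(2)] g(1) M0 cM UM z
        by (intro exI[of _ "insert g M0"]) auto
    qed
  qed
qed

text \<open>A k-matching M can be exchanged for a larger matching that still covers V(M). An
  extension of the latter has a further edge, which avoids V(M); adding this edge to M gives a
  (k+1)-matching, which extends.\<close>

lemma nkd_graph_Suc_imp:
  assumes G: "simple_graph G" and nkd: "nkd_graph n (Suc k) d G"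
  shows "nkd_graph n k d G"
  unfolding nkd_graph_def
proof (intro conjI allI impI)
  show "n + 2 * k + d + 2 \<le> card (verts G)" "even (int (card (verts G)) - int n - int d)"
    using nkd by (auto simp: nkd_graph_def)
  fix S assume S: "S \<subseteq> verts G \<and> card S = n"
  define H where "H = delete_verts G S"
  have H: "simple_graph H" using simple_graph_delete_verts[OF G] by (simp add: H_def)
  have finS: "finite S" using S simple_graph_finite(1)[OF G] finite_subset by blast
  have cH: "card (verts H) = card (verts G) - n" using S finS by (simp add: H_def card_Diff_subset)
  have ext: "\<exists>M'. defect_matching d H M' \<and> M \<subseteq> M'" if "k_matching (Suc k) H M" for M
    using nkd S that unfolding nkd_graph_def H_def by blast
  obtain N where N: "k_matching (Suc k) H N" using nkd S unfolding nkd_graph_def H_def by blast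
  obtain N1 where "N1 \<subseteq> N" "card N1 = k"
    using obtain_subset_with_card_n[of k N] N by (auto simp: k_matching_def)
  then show "\<exists>M. k_matching k (delete_verts G S) M"
    using N matching_subset unfolding k_matching_def H_def by blast
  fix M assume "k_matching k (delete_verts G S) M"
  then have M: "matching H M" "card M = k" by (auto simp: k_matching_def H_def)
  obtain M1 where M1: "matching H M1" "card M1 = Suc k" "\<Union>M \<subseteq> \<Union>M1"
    using matching_exchange[OF H M(1), of N] N M(2) by (auto simp: k_matching_def)
  obtain D where D: "defect_matching d H D" "M1 \<subseteq> D"
    using ext[of M1] M1 unfolding k_matching_def by blast
  have Dm: "matching H D" using D by (simp add: defect_matching_def)
  have "2 * card D + d = card (verts G) - n"
    using D matching_card_Union[OF H Dm] cH by (simp add: defect_matching_def)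
  \<comment> \<open>The spare 2 in the size bound gives \<open>D\<close> at least k + 2 edges, so
    one lies outside \<open>M1\<close>.\<close>
  moreover have "n + 2 * Suc k + d + 2 \<le> card (verts G)" using nkd by (simp add: nkd_graph_def)
  ultimately have "card M1 < card D" using M1(2) by arith
  then obtain e where e: "e \<in> D" "e \<notin> M1" using D(2) by (metis nat_neq_iff subsetI subset_antisym)
  have "\<Union>(D - M1) \<inter> \<Union>M1 = {}" using matching_Diff_disjoint[OF Dm D(2)] .
  then have dj: "e \<inter> \<Union>M = {}" using e M1(3) by blast
  have eE: "e \<in> edges H" using e Dm by (auto simp: matching_def)
  then have "e \<noteq> {}" using simple_graph_edgeD(2)[OF H] by fastforce
  then obtain x where "x \<in> e" by blast
  then have "k_matching (Suc k) H (insert e M)"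
    using matching_insert[OF M(1) eE dj] card_insert_edge[OF matching_finite[OF H M(1)] dj] M(2)
    by (simp add: k_matching_def)
  then show "\<exists>M'. defect_matching d (delete_verts G S) M' \<and> M \<subseteq> M'"
    using ext unfolding H_def by blast
qed

section \<open>Gallai's lemma\<close>

definition maximum_matching :: "'a graph \<Rightarrow> 'a set set \<Rightarrow> bool" where
  "maximum_matching G M \<longleftrightarrow> matching G M \<and> (\<forall>N. matching G N \<longrightarrow> card N \<le> card M)"

text \<open>The relation of Gallai's proof. Allowing \<open>x = y\<close> makes it reflexive; it
  contains adjacency and is transitive through any vertex that some maximum matching misses.\<close>

definition never_both_missed :: "'a graph \<Rightarrow> 'a \<Rightarrow> 'a \<Rightarrow> bool" where
  "never_both_missed G x y \<longleftrightarrow>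
     x = y \<or> (\<forall>M. maximum_matching G M \<longrightarrow> x \<in> \<Union>M \<or> y \<in> \<Union>M)"

text \<open>An edge with both ends missed could be added to the matching.\<close>

lemma never_both_missed_adjacent:
  assumes "simple_graph G" "{x, y} \<in> edges G"
  shows "never_both_missed G x y"
proof -
  have False if M: "maximum_matching G M" and "x \<notin> \<Union>M" "y \<notin> \<Union>M" for M
  proof -
    have dj: "{x, y} \<inter> \<Union>M = {}" using that by auto
    have m: "matching G M" using M by (simp add: maximum_matching_def)
    have "card (insert {x, y} M) = Suc (card M)"
      using card_insert_edge[OF matching_finite[OF assms(1) m] dj] by blast
    moreover have "card (insert {x, y} M) \<le> card M"
      using M matching_insert[OF m assms(2) dj] by (simp add: maximum_matching_def)
    ultimately show False by simp
  qed
  then show ?thesis by (auto simp: never_both_missed_def)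
qed

text \<open>The core of Gallai's lemma.  Given a maximum matching \<open>N\<close> missing \<open>x\<close> and \<open>y\<close>, a maximum
  matching \<open>M\<close> missing \<open>t\<close> with \<open>M \<inter> N\<close> as large as possible can be rotated along an \<open>N\<close>-edge
  at a second vertex that is missed by \<open>M\<close> only, which enlarges \<open>M \<inter> N\<close>.\<close>

lemma never_both_missed_trans:
  assumes G: "simple_graph G"
    and t: "maximum_matching G M0" "t \<notin> \<Union>M0"
    and xt: "never_both_missed G x t" and ty: "never_both_missed G t y"
    and V: "x \<in> verts G" "y \<in> verts G"
  shows "never_both_missed G x y"
proof (rule ccontr)
  assume "\<not> never_both_missed G x y"
  then obtain N where xy: "x \<noteq> y" and N: "maximum_matching G N" "x \<notin> \<Union>N" "y \<notin> \<Union>N"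
    by (auto simp: never_both_missed_def)
  have tN: "t \<in> \<Union>N" using xt ty N xy unfolding never_both_missed_def by blast
  then have txy: "t \<noteq> x" "t \<noteq> y" using N by auto
  have Nm: "matching G N" using N by (simp add: maximum_matching_def)
  have finN: "finite N" using matching_finite[OF G Nm] .
  define P where "P M \<longleftrightarrow> maximum_matching G M \<and> t \<notin> \<Union>M" for M
  have "\<exists>M. P M \<and> (\<forall>M'. P M' \<longrightarrow> card (M' \<inter> N) \<le> card (M \<inter> N))"
  \<comment> \<open>The successor is there because the rule asks for a strict bound.\<close>
  proof (rule ex_has_greatest_nat[of P M0 "\<lambda>M. card (M \<inter> N)" "Suc (card N)"])
    show "P M0" using t by (simp add: P_def)
    show "\<forall>M. P M \<longrightarrow> card (M \<inter> N) < Suc (card N)"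
      using finN by (simp add: card_mono less_Suc_eq_le)
  qed
  then obtain M where PM: "P M" and best: "\<And>M'. P M' \<Longrightarrow> card (M' \<inter> N) \<le> card (M \<inter> N)"
    by blast
  have Mmax: "maximum_matching G M" and tM: "t \<notin> \<Union>M" using PM by (auto simp: P_def)
  have Mm: "matching G M" using Mmax by (simp add: maximum_matching_def)
  have finM: "finite M" using matching_finite[OF G Mm] .
  have xyM: "x \<in> \<Union>M" "y \<in> \<Union>M"
    using xt ty Mmax tM txy unfolding never_both_missed_def by blast+
  \<comment> \<open>Both matchings cover equally many vertices. As x and y are covered by
    \<open>M\<close> only, at least two vertices are covered by \<open>N\<close> only: one is t,
    another serves as a.\<close>
  have "card M = card N" using Mmax N by (simp add: maximum_matching_def le_antisym)
  then have cU: "card (\<Union>M) = card (\<Union>N)" using matching_card_Union[OF G] Mm Nm by simp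
  have finU: "finite (\<Union>M)" "finite (\<Union>N)"
    using matching_Union_subset[OF G] Mm Nm simple_graph_finite(1)[OF G] finite_subset by blast+
  have "card (\<Union>M - \<Union>N) = card (\<Union>N - \<Union>M)"
    using cU finU by (metis card_Diff_subset_Int finite_Int inf_commute)
  moreover have "card {x, y} \<le> card (\<Union>M - \<Union>N)"
    by (rule card_mono) (use finU xyM N in auto)
  ultimately have "2 \<le> card (\<Union>N - \<Union>M)" using xy by simp
  then have "\<not> \<Union>N - \<Union>M \<subseteq> {t}" using card_mono[of "{t}" "\<Union>N - \<Union>M"] by auto
  then obtain a f where a: "f \<in> N" "a \<in> f" "a \<notin> \<Union>M" "a \<noteq> t" by blast
  have fE: "f \<in> edges G" using a Nm by (auto simp: matching_def)
  obtain b where b: "f = {a, b}" "b \<noteq> a" using simple_graph_edge_other_end[OF G fE a(2)] by metis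
  have "b \<in> \<Union>M"
    using never_both_missed_adjacent[OF G, of a b] fE b a(3) Mmax
    unfolding never_both_missed_def by blast
  then obtain g where g: "g \<in> M" "b \<in> g" by blast
  have gN: "g \<notin> N" using matching_unique_edge[OF Nm a(1), of g b] g b a by auto
  have fM: "f \<notin> M" using a by auto
  have dj: "f \<inter> \<Union>(M - {g}) = {}"
    using matching_Diff_disjoint[OF Mm, of "{g}"] g b a(3) by auto
  \<comment> \<open>The swap gains the \<open>N\<close>-edge \<open>f\<close> and loses
    \<open>g\<close>, which is not in \<open>N\<close>; it still misses t, against the choice of
    \<open>M\<close>.\<close>
  define M' where "M' = insert f (M - {g})"
  have "matching G M'"
    unfolding M'_def using matching_insert[OF matching_subset[OF Mm] fE dj] by auto
  moreover have "card M' = card M"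
    unfolding M'_def using finM fM g by (metis card_Suc_Diff1 card_insert_disjoint finite_Diff Diff_iff)
  ultimately have "maximum_matching G M'" using Mmax by (simp add: maximum_matching_def)
  moreover have "t \<notin> \<Union>M'" unfolding M'_def using tM a(4) b g \<open>b \<in> \<Union>M\<close> by auto
  ultimately have "card (M' \<inter> N) \<le> card (M \<inter> N)" by (intro best) (simp add: P_def)
  moreover have "M' \<inter> N = insert f (M \<inter> N)" unfolding M'_def using a(1) gN by auto
  ultimately show False using fM finM by simp
qed

section \<open>Components and parity\<close>

lemma reachable_self: "x \<in> verts G \<Longrightarrow> (x, x) \<in> reachable G"
  by (simp add: reachable_def)

lemma equiv_reachable: "equiv (verts G) (reachable G)"
proof (rule equivI)
  show "reachable G \<subseteq> verts G \<times> verts G" by (auto simp: reachable_def)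
  show "refl_on (verts G) (reachable G)" by (auto simp: refl_on_def reachable_def)
  have "sym ({(a, b). {a, b} \<in> edges G}\<^sup>*)"
    by (rule sym_rtrancl) (auto simp: sym_def insert_commute)
  then show "sym (reachable G)" by (auto simp: reachable_def sym_def)
  show "trans (reachable G)" by (auto simp: reachable_def trans_def intro: rtrancl_trans)
qed

lemma componentsE:
  assumes "C \<in> components G"
  obtains x where "x \<in> verts G" "C = induced_subgraph G (reachable G `` {x})"
  using assms by (auto simp: components_def elim!: quotientE)

lemma verts_induced_class [simp]:
  "verts (induced_subgraph G (reachable G `` {x})) = reachable G `` {x}"
  by (auto simp: induced_subgraph_def reachable_def)

lemma induced_class_in_components:
  "x \<in> verts G \<Longrightarrow> induced_subgraph G (reachable G `` {x}) \<in> components G"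
  by (simp add: components_def quotientI)

lemma edge_subset_class:
  assumes "simple_graph G" "e \<in> edges G" "y \<in> e" "y \<in> reachable G `` {x}"
  shows "e \<subseteq> reachable G `` {x}"
proof -
  obtain z where z: "e = {y, z}" "z \<in> verts G"
    using simple_graph_edge_other_end[OF assms(1-3)] by metis
  have "y \<in> verts G" using assms(4) by (auto simp: reachable_def)
  then have "(y, z) \<in> reachable G" using z assms(2) by (auto simp: reachable_def)
  then have "(x, z) \<in> reachable G"
    using assms(4) equiv_reachable[of G] by (auto simp: equiv_def dest: transD)
  then show ?thesis using z assms(4) by auto
qed

lemma components_disjoint:
  assumes "C \<in> components G" "D \<in> components G" "y \<in> verts C" "y \<in> verts D"
  shows "C = D"
proof -
  obtain a where a: "C = induced_subgraph G (reachable G `` {a})" using assms(1) by (rule componentsE)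
  obtain b where b: "D = induced_subgraph G (reachable G `` {b})" using assms(2) by (rule componentsE)
  have "(a, y) \<in> reachable G" "(b, y) \<in> reachable G" using assms a b by auto
  then have "reachable G `` {a} = reachable G `` {b}"
    using equiv_class_eq[OF equiv_reachable] by metis
  then show ?thesis using a b by simp
qed

text \<open>If all of \<open>K\<close> were covered, the edges of \<open>M\<close> inside
  \<open>K\<close> would split it into pairs.\<close>

lemma odd_set_missed:
  assumes G: "simple_graph G" and M: "matching G M" and K: "odd (card K)"
    and closed: "\<And>e. e \<in> M \<Longrightarrow> e \<inter> K \<noteq> {} \<Longrightarrow> e \<subseteq> K"
  shows "\<exists>x\<in>K. x \<notin> \<Union>M"
proof (rule ccontr)
  assume "\<not> ?thesis"
  then have cov: "\<exists>e\<in>M. x \<in> e" if "x \<in> K" for x using that by auto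
  have "K = \<Union>{e \<in> M. e \<subseteq> K}"
  proof (intro equalityI subsetI)
    fix x assume x: "x \<in> K"
    then obtain e where "e \<in> M" "x \<in> e" using cov by blast
    then show "x \<in> \<Union>{e \<in> M. e \<subseteq> K}" using closed[of e] x by auto
  qed auto
  moreover have "matching G {e \<in> M. e \<subseteq> K}" by (rule matching_subset[OF M]) auto
  ultimately have "card K = 2 * card {e \<in> M. e \<subseteq> K}" using matching_card_Union[OF G] by metis
  then show False using K by simp
qed

lemma finite_components: "simple_graph G \<Longrightarrow> finite (components G)"
  using finite_quotient[of "verts G" "reachable G"] simple_graph_finite(1)
  by (auto simp: components_def reachable_def)

section \<open>From the vertex set S to the failure of the extension property\<close>

text \<open>A matching of \<open>G - uv\<close> avoiding \<open>S\<close> misses \<open>u\<close>, \<open>v\<close> and a vertex of each odd component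
  of \<open>G - S\<close>, hence at least \<open>d + 2\<close> vertices.\<close>

lemma not_nkd_graph_delete_edge:
  assumes G: "simple_graph G" and uv: "u \<noteq> v"
    and S: "S \<subseteq> verts G" "card S = n + 2 * m"
    and M: "k_matching m (induced_subgraph G S) M"
    and single: "single_edge u v \<in> components (delete_verts G S)"
    and d: "card (components (delete_verts G S) - {single_edge u v}) = d"
    and oddC: "\<forall>C \<in> components (delete_verts G S) - {single_edge u v}. odd (card (verts C))"
  shows "\<not> nkd_graph n m d (delete_edge G {u, v})"
proof
  assume nkd: "nkd_graph n m d (delete_edge G {u, v})"
  define R where "R = delete_verts G S"
  define Cs where "Cs = components R - {single_edge u v}"
  note G' = simple_graph_delete_edge[OF G, of "{u, v}"]
  have R: "simple_graph R" unfolding R_def using simple_graph_delete_verts[OF G] .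
  have finV: "finite (verts G)" and finS: "finite S"
    using simple_graph_finite(1)[OF G] S(1) finite_subset by auto
  have Mm: "matching G M" and MS: "\<Union>M \<subseteq> S" and cM: "card M = m"
    using M by (auto simp: k_matching_def matching_def induced_subgraph_def)
  obtain w where w: "w \<in> verts R" "single_edge u v = induced_subgraph R (reachable R `` {w})"
    using single unfolding R_def by (rule componentsE)
  have cls: "reachable R `` {w} = {u, v}"
    using arg_cong[OF w(2), of verts] by (simp add: single_edge_def)
  then have uvR: "u \<in> verts R" "v \<in> verts R" by (auto simp: reachable_def)
  then have uvS: "u \<notin> S" "v \<notin> S" "u \<in> verts G" "v \<in> verts G" by (auto simp: R_def)
  \<comment> \<open>Deleting only these n vertices keeps \<open>M\<close> in the graph as an
    m-matching that has to extend.\<close>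
  define S' where "S' = S - \<Union>M"
  have S': "S' \<subseteq> verts G" "S' \<subseteq> S" using S by (auto simp: S'_def)
  have "finite (\<Union>M)" using MS finS by (rule finite_subset)
  then have cS': "card S' = n"
    using card_Diff_subset[OF _ MS] matching_card_Union[OF G Mm] cM S(2) by (simp add: S'_def)
  have "{u, v} \<notin> M" using MS uvS by auto
  then have "k_matching m (delete_verts (delete_edge G {u, v}) S') M"
    using Mm cM by (auto simp: k_matching_def matching_delete_verts_iff[OF G'] matching_delete_edge_iff S'_def)
  then obtain D where D: "defect_matching d (delete_verts (delete_edge G {u, v}) S') D" "M \<subseteq> D"
    using nkd S' cS' unfolding nkd_graph_def verts_delete_edge by blast
  have Dm: "matching G D" and uvD: "{u, v} \<notin> D" and DS: "\<Union>D \<inter> S' = {}"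
    and cD: "card (\<Union>D) + d = card (verts G - S')"
    using D(1) by (simp_all add: defect_matching_def matching_delete_verts_iff[OF G'] matching_delete_edge_iff)
  define N where "N = D - M"
  have NM: "\<Union>N \<inter> \<Union>M = {}" unfolding N_def using matching_Diff_disjoint[OF Dm D(2)] .
  have NS: "\<Union>N \<inter> S = {}" 
  proof -
    have "\<Union>N \<inter> S' = {}" using DS by (auto simp: N_def)
    then show ?thesis using NM unfolding S'_def by blast
  qed
  have Nm: "matching R N"
    unfolding R_def matching_delete_verts_iff[OF G] using matching_subset[OF Dm, of N] NS by (auto simp: N_def)
  have NE: "e \<in> edges R" if "e \<in> N" for e using Nm that by (auto simp: matching_def)
  \<comment> \<open>The component leaves uv as the only edge of \<open>R\<close> at u or v, and
    \<open>D\<close> does not use it.\<close>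
  have missed_uv: "x \<notin> \<Union>N" if x: "x \<in> {u, v}" for x
  proof
    assume "x \<in> \<Union>N"
    then obtain e where e: "e \<in> N" "x \<in> e" by blast
    have "e \<subseteq> {u, v}" using edge_subset_class[OF R NE[OF e(1)] e(2), of w] x cls by simp
    then have "e = {u, v}"
      using simple_graph_edgeD(2)[OF R NE[OF e(1)]] uv by (simp add: card_subset_eq)
    then show False using e uvD by (simp add: N_def)
  qed
  have "\<exists>x\<in>verts C. x \<notin> \<Union>N" if C: "C \<in> Cs" for C
  proof (rule odd_set_missed[OF R Nm])
    show "odd (card (verts C))" using oddC C by (simp add: Cs_def R_def)
    obtain z where "C = induced_subgraph R (reachable R `` {z})"
      using C by (auto simp: Cs_def elim: componentsE)
    then show "e \<subseteq> verts C" if "e \<in> N" "e \<inter> verts C \<noteq> {}" for e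
      using edge_subset_class[OF R NE[OF that(1)]] that(2) by auto
  qed
  \<comment> \<open>One missed vertex per odd component; disjointness of components makes the choice
    injective and keeps it off u and v.\<close>
  then obtain f where f: "\<And>C. C \<in> Cs \<Longrightarrow> f C \<in> verts C" "\<And>C. C \<in> Cs \<Longrightarrow> f C \<notin> \<Union>N"
    by metis
  have finC: "finite Cs" unfolding Cs_def using finite_components[OF R] by simp
  have inj: "inj_on f Cs"
    by (rule inj_onI) (use f(1) components_disjoint in \<open>metis Cs_def DiffD1\<close>)
  have not_uv: "f C \<notin> {u, v}" if C: "C \<in> Cs" for C
  proof
    assume "f C \<in> {u, v}"
    then have "f C \<in> verts (single_edge u v)" by (simp add: single_edge_def)
    then have "C = single_edge u v"
      using components_disjoint[of C R "single_edge u v"] C f(1)[OF C] single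
      by (simp add: Cs_def R_def)
    then show False using C by (simp add: Cs_def)
  qed
  have "card (f ` Cs \<union> {u, v}) = card (f ` Cs) + card {u, v}"
    by (rule card_Un_disjoint) (use finC not_uv in auto)
  then have "card (f ` Cs \<union> {u, v}) = d + 2"
    using card_image[OF inj] d uv by (simp add: Cs_def R_def)
  moreover have "card (f ` Cs \<union> {u, v}) \<le> card ((verts G - S') - \<Union>D)"
  proof (rule card_mono)
    have "C \<in> Cs \<Longrightarrow> verts C \<subseteq> verts R" for C
      unfolding Cs_def by (auto simp: components_def induced_subgraph_def)
    then have sub: "f ` Cs \<union> {u, v} \<subseteq> verts R" using f(1) uvR by blast
    have UD: "\<Union>D = \<Union>M \<union> \<Union>N" using D(2) by (auto simp: N_def)
    show "f ` Cs \<union> {u, v} \<subseteq> (verts G - S') - \<Union>D"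
    proof
      fix x assume x: "x \<in> f ` Cs \<union> {u, v}"
      then have "x \<in> verts G" "x \<notin> S" using subsetD[OF sub] by (simp_all add: R_def)
      moreover have "x \<notin> S'" "x \<notin> \<Union>M" using \<open>x \<notin> S\<close> S'(2) MS by (blast dest: subsetD)+
      moreover have "x \<notin> \<Union>N" using x f(2) missed_uv by (elim UnE imageE) simp_all
      ultimately show "x \<in> (verts G - S') - \<Union>D" using UD by simp
    qed
  qed (use finV in simp)
  moreover have "card ((verts G - S') - \<Union>D) = d"
  proof -
    have sub: "\<Union>D \<subseteq> verts G - S'" using matching_Union_subset[OF G Dm] DS by auto
    have "finite (\<Union>D)" using sub finV by (meson finite_Diff finite_subset)
    then show ?thesis using card_Diff_subset[OF _ sub] cD by simp
  qed
  ultimately show False by simp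
qed

section \<open>From the failure of the extension property to the vertex set S\<close>

text \<open>Let \<open>M\<close> be an \<open>m\<close>-matching of \<open>G - uv - S\<^sub>0\<close> with no defect-\<open>d\<close> extension, and
  \<open>R = G - S\<^sub>0 - V(M)\<close>.  A second edge of \<open>R\<close> at \<open>u\<close> or \<open>v\<close> could be added to \<open>M\<close> before
  extending, which would keep \<open>uv\<close> out of the extension; so \<open>uv\<close> is a component of \<open>R\<close>.  By its
  degree, \<open>u\<close> has a neighbour \<open>s\<close> in \<open>S\<^sub>0\<close>.  Extending \<open>M + us\<close> after exchanging \<open>s\<close> in \<open>S\<^sub>0\<close>
  for a vertex \<open>y\<close> of \<open>Q = R - {u, v}\<close> gives a maximum matching of \<open>Q\<close> that misses \<open>y\<close>, so
  Gallai's lemma applies to \<open>Q\<close>.\<close>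

lemma nkd_graph_delete_edge_witness:
  assumes G: "simple_graph G" and nkd: "nkd_graph n (Suc m) d G"
    and uvE: "{u, v} \<in> edges G" and deg: "degree G u \<ge> 2 * Suc m"
    and not_nkd: "\<not> nkd_graph n m d (delete_edge G {u, v})"
  shows "\<exists>S. S \<subseteq> verts G \<and> card S = n + 2 * m \<and>
    (\<exists>M. k_matching m (induced_subgraph G S) M) \<and>
    single_edge u v \<in> components (delete_verts G S) \<and>
    card (components (delete_verts G S) - {single_edge u v}) = d \<and>
    (\<forall>C \<in> components (delete_verts G S) - {single_edge u v}.
       odd (card (verts C)) \<and> factor_critical C)"
proof -
  note G' = simple_graph_delete_edge[OF G, of "{u, v}"]
  have finV: "finite (verts G)" using simple_graph_finite(1)[OF G] .
  have uv: "u \<noteq> v" using simple_graph_edgeD(2)[OF G uvE] by auto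
  have size: "n + 2 * Suc m + d + 2 \<le> card (verts G)"
    and par: "even (int (card (verts G)) - int n - int d)"
    using nkd by (simp_all add: nkd_graph_def)
  \<comment> \<open>The size of the matching is left open because the property is applied both to m
    and to m + 1 edges.\<close>
  have ext: "\<exists>D. matching G D \<and> N \<subseteq> D \<and> \<Union>D \<inter> S = {} \<and> 2 * card D + d + n = card (verts G)"
    if S: "S \<subseteq> verts G" "card S = n" and N: "matching G N" "\<Union>N \<inter> S = {}" and k: "nkd_graph n (card N) d G"
    for S N
  proof -
    have "k_matching (card N) (delete_verts G S) N"
      using N by (simp add: k_matching_def matching_delete_verts_iff[OF G])
    then obtain D where D: "defect_matching d (delete_verts G S) D" "N \<subseteq> D"
      using k S unfolding nkd_graph_def by blast
    then have Dm: "matching G D" "\<Union>D \<inter> S = {}" "card (\<Union>D) + d = card (verts G - S)"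
      by (simp_all add: defect_matching_def matching_delete_verts_iff[OF G])
    moreover have "card (verts G - S) + n = card (verts G)"
      using S finV by (metis card_Diff_subset card_mono finite_subset le_add_diff_inverse2)
    ultimately show ?thesis using D(2) matching_card_Union[OF G Dm(1)] by (intro exI[of _ D]) simp
  qed
  have nkd': "nkd_graph n m d G" using nkd_graph_Suc_imp[OF G nkd] .

  \<comment> \<open>Only extension can fail: size and parity do not depend on edges, and an
    (m+1)-matching retains m edges without uv.\<close>
  obtain S0 M where S0: "S0 \<subseteq> verts G" "card S0 = n"
    and M: "k_matching m (delete_verts (delete_edge G {u, v}) S0) M"
    and noext: "\<And>D. M \<subseteq> D \<Longrightarrow> \<not> defect_matching d (delete_verts (delete_edge G {u, v}) S0) D"
  proof -
    have "\<exists>M. k_matching m (delete_verts (delete_edge G {u, v}) S) M"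
      if S: "S \<subseteq> verts G" "card S = n" for S
    proof -
      obtain N where N: "k_matching (Suc m) (delete_verts G S) N"
        using nkd S unfolding nkd_graph_def by blast
      have "m \<le> card (N - {{u, v}})"
        using N card_Diff1_le[of N "{u, v}"] by (cases "{u, v} \<in> N") (auto simp: k_matching_def)
      then obtain N1 where N1: "N1 \<subseteq> N - {{u, v}}" "card N1 = m"
        using obtain_subset_with_card_n by metis
      have "matching G N" "\<Union>N \<inter> S = {}"
        using N by (simp_all add: k_matching_def matching_delete_verts_iff[OF G])
      then have "k_matching m (delete_verts (delete_edge G {u, v}) S) N1"
        using N1 matching_subset[of G N N1]
        by (auto simp: k_matching_def matching_delete_verts_iff[OF G'] matching_delete_edge_iff)
      then show ?thesis by blast
    qed
    note m_matching = this
    have "\<exists>S M. S \<subseteq> verts G \<and> card S = n \<and>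
        k_matching m (delete_verts (delete_edge G {u, v}) S) M \<and>
        \<not> (\<exists>D. defect_matching d (delete_verts (delete_edge G {u, v}) S) D \<and> M \<subseteq> D)"
    proof (rule ccontr)
      assume no: "\<not> ?thesis"
      have "nkd_graph n m d (delete_edge G {u, v})"
        unfolding nkd_graph_def verts_delete_edge
      proof (intro conjI allI impI)
        show "n + 2 * m + d + 2 \<le> card (verts G)" using size by simp
      next
        show "even (int (card (verts G)) - int n - int d)" by (rule par)
      next
        fix S assume "S \<subseteq> verts G \<and> card S = n"
        then show "\<exists>M. k_matching m (delete_verts (delete_edge G {u, v}) S) M"
          using m_matching by blast
      next
        fix S M assume "S \<subseteq> verts G \<and> card S = n"
          "k_matching m (delete_verts (delete_edge G {u, v}) S) M"
        then show "\<exists>D. defect_matching d (delete_verts (delete_edge G {u, v}) S) D \<and> M \<subseteq> D"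
          using no by blast
      qed
      then show False using not_nkd by simp
    qed
    then show thesis using that by blast
  qed
  have Mm: "matching G M" and uvM: "{u, v} \<notin> M" and MS0: "\<Union>M \<inter> S0 = {}" and cM: "card M = m"
    using M by (simp_all add: k_matching_def matching_delete_verts_iff[OF G'] matching_delete_edge_iff)
  have finM: "finite M" using matching_finite[OF G Mm] .
  have MV: "\<Union>M \<subseteq> verts G" using matching_Union_subset[OF G Mm] .
  have finS0: "finite S0" and finUM: "finite (\<Union>M)" using finite_subset[OF S0(1) finV] finite_subset[OF MV finV] by auto
  have cUM: "card (\<Union>M) = 2 * m" using matching_card_Union[OF G Mm] cM by simp

  have uv_forced: "{u, v} \<in> D"
    if D: "matching G D" "M \<subseteq> D" "\<Union>D \<inter> S0 = {}" "2 * card D + d + n = card (verts G)" for D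
  proof (rule ccontr)
    assume "{u, v} \<notin> D"
    moreover have "card (\<Union>D) + d = card (verts G - S0)"
      using D(4) S0 finS0 matching_card_Union[OF G D(1)] by (simp add: card_Diff_subset)
    ultimately show False using noext[OF D(2)] D
      by (simp add: defect_matching_def matching_delete_verts_iff[OF G'] matching_delete_edge_iff)
  qed

  define S where "S = S0 \<union> \<Union>M"
  define R where "R = delete_verts G S"
  define Q where "Q = delete_verts G (S \<union> {u, v})"
  have SV: "S \<subseteq> verts G" using S0 MV by (simp add: S_def)
  have finS: "finite S" using finS0 finUM by (simp add: S_def)
  have cS: "card S = n + 2 * m"
    unfolding S_def using card_Un_disjoint[OF finS0 finUM] MS0 S0(2) cUM by auto
  have R: "simple_graph R" and Q: "simple_graph Q"
    unfolding R_def Q_def using simple_graph_delete_verts[OF G] by blast+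
  \<comment> \<open>Some extension of \<open>M\<close> in \<open>G\<close> contains uv; since uv is
    not in \<open>M\<close>, its ends avoid V(M) as well as \<open>S0\<close>.\<close>
  have uvR: "u \<in> verts R" "v \<in> verts R"
  proof -
    obtain D where D: "matching G D" "M \<subseteq> D" "\<Union>D \<inter> S0 = {}" "2 * card D + d + n = card (verts G)"
      using ext[OF S0 Mm MS0] nkd' cM by auto
    have "{u, v} \<in> D" using uv_forced[OF D] .
    moreover have "\<Union>(D - M) \<inter> \<Union>M = {}" using matching_Diff_disjoint[OF D(1,2)] .
    ultimately show "u \<in> verts R" "v \<in> verts R"
      using uvM D(3) simple_graph_edgeD(1)[OF G uvE] by (auto simp: R_def S_def)
  qed
  then have uvV: "u \<in> verts G" "v \<in> verts G" and uvS: "u \<notin> S" "v \<notin> S" by (auto simp: R_def)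
  have uvER: "{u, v} \<in> edges R" using uvE uvV uvS by (simp add: R_def)
  have edge_uv: "e = {u, v}" if e: "e \<in> edges R" "e \<inter> {u, v} \<noteq> {}" for e
  proof (rule ccontr)
    assume ne: "e \<noteq> {u, v}"
    have eG: "e \<in> edges G" and eS: "e \<inter> S = {}" using e(1) by (auto simp: R_def)
    obtain x where x: "x \<in> e" "x \<in> {u, v}" using e(2) by blast
    have dj: "e \<inter> \<Union>M = {}" using eS by (auto simp: S_def)
    have "card (insert e M) = Suc m" using card_insert_edge[OF finM dj x(1)] cM by simp
    moreover have "\<Union>(insert e M) \<inter> S0 = {}" using eS MS0 by (auto simp: S_def)
    ultimately obtain D where D: "matching G D" "insert e M \<subseteq> D" "\<Union>D \<inter> S0 = {}"
      "2 * card D + d + n = card (verts G)"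
      using ext[OF S0 matching_insert[OF Mm eG dj]] nkd by auto
    then have "{u, v} \<in> D" using uv_forced by simp
    then show False using matching_unique_edge[OF D(1), of e "{u, v}" x] D(2) x ne by simp
  qed

  \<comment> \<open>Neighbours of u outside \<open>S0\<close> are v or lie in V(M), so there are at
    most 2m + 1 of them, fewer than the degree.\<close>
  obtain s where s: "s \<in> S0" "{u, s} \<in> edges G"
  proof (rule ccontr)
    assume no: "\<not> thesis"
    have "{e \<in> edges G. u \<in> e} \<subseteq> (\<lambda>w. {u, w}) ` (insert v (\<Union>M))"
    proof
      fix e assume e: "e \<in> {e \<in> edges G. u \<in> e}"
      then obtain w where w: "e = {u, w}" "w \<in> verts G"
        using simple_graph_edge_other_end[OF G, of e u] by auto
      have "w \<notin> S0" using no that e w by auto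
      moreover have "w = v" if "w \<notin> S"
        using edge_uv[of e] e w that uvV uvS by (auto simp: R_def doubleton_eq_iff)
      ultimately show "e \<in> (\<lambda>w. {u, w}) ` (insert v (\<Union>M))" using w by (auto simp: S_def)
    qed
    then have "degree G u \<le> card (insert v (\<Union>M))"
      unfolding degree_def using finUM by (meson card_image_le card_mono finite_imageI finite_insert le_trans)
    also have "\<dots> \<le> Suc (2 * m)" using finUM cUM by (simp add: card_insert_if)
    finally show False using deg by simp
  qed
  have sS: "s \<notin> \<Union>M" "s \<noteq> u" using s MS0 uvS by (auto simp: S_def)

  have cQ: "card (verts Q) + n + 2 * Suc m = card (verts G)"
  proof -
    have "card (S \<union> {u, v}) = n + 2 * Suc m"
      using uvS uv finS cS by simp
    moreover have "S \<union> {u, v} \<subseteq> verts G" using SV uvV by simp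
    ultimately show ?thesis
      unfolding Q_def verts_delete_verts using card_Diff_subset[of "S \<union> {u, v}" "verts G"] finS finV
        card_mono[of "verts G" "S \<union> {u, v}"] by simp
  qed

  \<comment> \<open>By parity |Q| - d = 2j. A matching of Q with j + 1 edges, joined to
    \<open>M\<close>, would be a defect-d extension without uv.\<close>
  have Q_bound: "2 * card N + d \<le> card (verts Q)" if N: "matching Q N" for N
  proof (rule ccontr)
    assume less: "\<not> ?thesis"
    have dQ: "d \<le> card (verts Q)" using size cQ by simp
    have "int (card (verts Q) - d) = (int (card (verts G)) - int n - int d) - 2 * int (Suc m)"
      using cQ of_nat_diff[OF dQ, where 'a = int] by linarith
    then have "even (int (card (verts Q) - d))" by (simp only: par dvd_diff dvd_triv_left)
    then have "even (card (verts Q) - d)" by (simp only: even_of_nat)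
    then obtain j where "card (verts Q) - d = 2 * j" by (rule evenE)
    then have j: "card (verts Q) = 2 * j + d" using dQ by simp
    have "Suc j \<le> card N" using less j by simp
    then obtain N1 where N1: "N1 \<subseteq> N" "card N1 = Suc j" using obtain_subset_with_card_n by metis
    have N1m: "matching G N1" and N1S: "\<Union>N1 \<inter> (S \<union> {u, v}) = {}"
      using matching_subset[OF N N1(1)] by (simp_all add: Q_def matching_delete_verts_iff[OF G])
    have dj: "\<Union>M \<inter> \<Union>N1 = {}" using N1S by (auto simp: S_def)
    have D: "matching G (M \<union> N1)" using matching_Un[OF Mm N1m dj] .
    have "\<Union>N1 \<inter> S0 = {}" using N1S by (auto simp: S_def)
    then have "\<Union>(M \<union> N1) \<inter> S0 = {}" using MS0 by auto
    moreover have "2 * card (M \<union> N1) + d + n = card (verts G)"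
    proof -
      have "2 * card (M \<union> N1) = card (\<Union>M \<union> \<Union>N1)" using matching_card_Union[OF G D] by simp
      also have "\<dots> = card (\<Union>M) + card (\<Union>N1)"
        using dj finUM matching_Union_subset[OF G N1m] finV finite_subset by (intro card_Un_disjoint) blast+
      also have "\<dots> = 2 * m + 2 * Suc j" using matching_card_Union[OF G N1m] N1 cUM by simp
      finally show ?thesis using cQ j by simp
    qed
    ultimately have "{u, v} \<in> M \<union> N1" using uv_forced[OF D] by simp
    then show False using uvM N1S by auto
  qed

  \<comment> \<open>The set \<open>S1\<close> has room for y since s moves into the matching. The
    extension loses the m + 1 edges of \<open>M1\<close>; what remains lies in Q, because u is
    covered by \<open>M1\<close> and v has no other neighbour in \<open>R\<close>.\<close>
  have Q_missed: "\<exists>N. matching Q N \<and> y \<notin> \<Union>N \<and> 2 * card N + d = card (verts Q)"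
    if y: "y \<in> verts Q" for y
  proof -
    have yG: "y \<in> verts G" "y \<notin> S" "y \<notin> {u, v}" using y by (auto simp: Q_def)
    define S1 where "S1 = insert y (S0 - {s})"
    have "y \<notin> S0" using yG by (simp add: S_def)
    then have S1: "S1 \<subseteq> verts G" "card S1 = n"
      using S0 yG finS0 s(1) by (auto simp: S1_def card_Suc_Diff1 card_insert_if simp del: card_Diff_insert)
    have dj: "{u, s} \<inter> \<Union>M = {}" using sS uvS by (auto simp: S_def)
    define M1 where "M1 = insert {u, s} M"
    have M1m: "matching G M1" unfolding M1_def using matching_insert[OF Mm s(2) dj] .
    have cM1: "card M1 = Suc m" unfolding M1_def using card_insert_edge[OF finM dj, of u] cM by simp
    have "\<Union>M1 \<inter> S1 = {}" using yG MS0 uvS sS s by (auto simp: M1_def S1_def S_def)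
    then obtain D where D: "matching G D" "M1 \<subseteq> D" "\<Union>D \<inter> S1 = {}"
      "2 * card D + d + n = card (verts G)"
      using ext[OF S1 M1m] nkd cM1 by auto
    define N where "N = D - M1"
    have NM: "\<Union>N \<inter> \<Union>M1 = {}" unfolding N_def using matching_Diff_disjoint[OF D(1,2)] .
    have NS1: "\<Union>N \<inter> S1 = {}" using D(3) by (auto simp: N_def)
    have U1: "\<Union>M1 = {u, s} \<union> \<Union>M" by (simp add: M1_def)
    have NS: "\<Union>N \<inter> S = {}" "u \<notin> \<Union>N" "y \<notin> \<Union>N"
      using NM NS1 unfolding U1 S1_def S_def by blast+
    have Nm: "matching G N" using matching_subset[OF D(1)] by (simp add: N_def)
    have NR: "matching R N" unfolding R_def matching_delete_verts_iff[OF G] using Nm NS by simp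
    have "v \<notin> \<Union>N"
    proof
      assume "v \<in> \<Union>N"
      then obtain e where e: "e \<in> N" "v \<in> e" by blast
      then have "e = {u, v}" using edge_uv[of e] NR by (auto simp: matching_def)
      then show False using e NS(2) by auto
    qed
    then have "matching Q N" unfolding Q_def matching_delete_verts_iff[OF G] using Nm NS by auto
    moreover have "card N + Suc m = card D"
      using D(2) matching_finite[OF G D(1)] cM1 finite_subset
      by (metis N_def card_Diff_subset card_mono le_add_diff_inverse2)
    ultimately show ?thesis using D(4) cQ NS(3) by (intro exI[of _ N]) simp
  qed

  \<comment> \<open>The size bound leaves Q nonempty, so \<open>Q_missed\<close> shows that the
    bound is attained.\<close>
  have Q_max: "maximum_matching Q N \<longleftrightarrow> matching Q N \<and> 2 * card N + d = card (verts Q)" for N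
  proof
    assume N: "maximum_matching Q N"
    have "verts Q \<noteq> {}" using cQ size by auto
    then obtain y N' where "matching Q N'" "2 * card N' + d = card (verts Q)" using Q_missed by blast
    moreover have "card N' \<le> card N" using N calculation by (simp add: maximum_matching_def)
    moreover have "matching Q N" using N by (simp add: maximum_matching_def)
    ultimately show "matching Q N \<and> 2 * card N + d = card (verts Q)" using Q_bound[of N] by simp
  next
    assume N: "matching Q N \<and> 2 * card N + d = card (verts Q)"
    have "card N' \<le> card N" if "matching Q N'" for N' using Q_bound[OF that] N by simp
    then show "maximum_matching Q N" using N by (simp add: maximum_matching_def)
  qed

  \<comment> \<open>Transitivity is applied along a path; each intermediate vertex is missed by some
    maximum matching of Q.\<close>
  have conn: "y \<in> verts Q \<and> never_both_missed Q x y"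
    if x: "x \<in> verts Q" and xy: "(x, y) \<in> {(a, b). {a, b} \<in> edges R}\<^sup>*" for x y
    using xy
  proof (induction rule: rtrancl_induct)
    case base
    then show ?case using x by (simp add: never_both_missed_def)
  next
    case (step a b)
    have ab: "{a, b} \<in> edges R" using step by simp
    have aQ: "a \<in> verts Q" using step by simp
    have "{a, b} \<inter> {u, v} = {}"
    proof (rule ccontr)
      assume "{a, b} \<inter> {u, v} \<noteq> {}"
      then have "{a, b} = {u, v}" using edge_uv[OF ab] by simp
      then show False using aQ by (auto simp: Q_def)
    qed
    then have abQ: "{a, b} \<in> edges Q" using ab by (auto simp: Q_def R_def)
    then have bQ: "b \<in> verts Q" using simple_graph_edgeD(1)[OF Q] by blast
    obtain N where "maximum_matching Q N" "a \<notin> \<Union>N" using Q_missed[OF aQ] Q_max by blast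
    then show ?case
      using never_both_missed_trans[OF Q _ _ _ never_both_missed_adjacent[OF Q abQ] x bQ] step bQ by blast
  qed
  have class_uv: "reachable R `` {x} = {u, v}" if "x \<in> {u, v}" for x
  proof -
    have *: "y \<in> {u, v}" if "(z, y) \<in> {(a, b). {a, b} \<in> edges R}\<^sup>*" "z \<in> {u, v}" for z y
      using that
    proof (induction rule: rtrancl_induct)
      case (step a b)
      then have "{a, b} = {u, v}" by (intro edge_uv) auto
      then show ?case by auto
    qed
    have "(u, v) \<in> reachable R" "(v, u) \<in> reachable R" "(u, u) \<in> reachable R" "(v, v) \<in> reachable R"
      using uvER uvR by (auto simp: reachable_def insert_commute)
    then show ?thesis using * that by (auto simp: reachable_def)
  qed
  have ind_uv: "induced_subgraph R {u, v} = single_edge u v"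
  proof -
    have "e = {u, v}" if "e \<in> edges R" "e \<subseteq> {u, v}" for e
      using that simple_graph_edgeD(2)[OF R that(1)] uv by (simp add: card_subset_eq)
    then show ?thesis using uvR uvER by (auto simp: induced_subgraph_def single_edge_def)
  qed
  have single: "single_edge u v \<in> components R"
    using induced_class_in_components[OF uvR(1)] class_uv[of u] ind_uv by simp
  have QR: "verts Q = verts R - {u, v}" by (auto simp: Q_def R_def)

  define Cs where "Cs = components R - {single_edge u v}"
  have class_Q: "\<exists>x\<in>verts Q. C = induced_subgraph R (reachable R `` {x})" if "C \<in> Cs" for C
  proof -
    obtain x where x: "x \<in> verts R" "C = induced_subgraph R (reachable R `` {x})"
      using \<open>C \<in> Cs\<close> by (auto simp: Cs_def elim: componentsE)
    have "x \<notin> {u, v}" using class_uv[of x] ind_uv x \<open>C \<in> Cs\<close> by (auto simp: Cs_def)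
    then show ?thesis using x QR by blast
  qed
  have in_Cs: "induced_subgraph R (reachable R `` {x}) \<in> Cs" if x: "x \<in> verts Q" for x
  proof -
    have "x \<in> verts R" "x \<notin> {u, v}" using x QR by auto
    moreover have "x \<in> reachable R `` {x}" using reachable_self[OF \<open>x \<in> verts R\<close>] by simp
    ultimately have "reachable R `` {x} \<noteq> verts (single_edge u v)"
      by (auto simp: single_edge_def)
    then have "induced_subgraph R (reachable R `` {x}) \<noteq> single_edge u v"
      by (metis verts_induced_class)
    then show ?thesis using induced_class_in_components[OF \<open>x \<in> verts R\<close>] by (simp add: Cs_def)
  qed

  \<comment> \<open>Since \<open>N\<close> misses y, it covers every other vertex of the component,
    by edges that stay inside it.\<close>
  have pm: "perfect_matching (delete_verts (induced_subgraph R K) {y}) {e \<in> N. e \<subseteq> K}"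
    if x: "x \<in> verts Q" and K: "K = reachable R `` {x}" and yK: "y \<in> K"
      and N: "maximum_matching Q N" "y \<notin> \<Union>N" for x K y N
  proof -
    have KQ: "K \<subseteq> verts Q" using conn[OF x] by (auto simp: K reachable_def)
    have KR: "K \<subseteq> verts R" using KQ QR by blast
    have Nm: "matching Q N" using N by (simp add: maximum_matching_def)
    have NR: "e \<in> edges R" if "e \<in> N" for e using Nm that by (auto simp: matching_def Q_def R_def)
    have verts: "verts (delete_verts (induced_subgraph R K) {y}) = K - {y}"
      using KR by (auto simp: induced_subgraph_def)
    have "\<Union>{e \<in> N. e \<subseteq> K} = K - {y}"
    proof (intro equalityI subsetI)
      fix z assume z: "z \<in> K - {y}"
      have "(y, z) \<in> reachable R"
        using yK z equiv_reachable[of R] unfolding K equiv_def by (auto dest: symD transD)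
      then have "never_both_missed Q y z" using conn[of y z] KQ yK by (auto simp: reachable_def)
      then have "z \<in> \<Union>N" using N z by (auto simp: never_both_missed_def)
      then obtain e where e: "e \<in> N" "z \<in> e" by blast
      then have "e \<subseteq> K" using edge_subset_class[OF R NR[OF e(1)] e(2), of x] z K by simp
      then show "z \<in> \<Union>{e \<in> N. e \<subseteq> K}" using e by blast
    qed (use N(2) in auto)
    moreover have "matching (delete_verts (induced_subgraph R K) {y}) {e \<in> N. e \<subseteq> K}"
      using Nm NR N(2) KR unfolding matching_def by (auto simp: induced_subgraph_def)
    ultimately show ?thesis using verts by (simp add: perfect_matching_def)
  qed
  have fc: "odd (card (verts C)) \<and> factor_critical C" if C: "C \<in> Cs" for C
  proof -
    obtain x where x: "x \<in> verts Q" "C = induced_subgraph R (reachable R `` {x})"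
      using class_Q[OF C] by blast
    have KQ: "reachable R `` {x} \<subseteq> verts Q" using conn[OF x(1)] by (auto simp: reachable_def)
    have P: "\<exists>N. perfect_matching (delete_verts C {y}) N \<and> matching G N" if y: "y \<in> verts C" for y
    proof -
      have yK: "y \<in> reachable R `` {x}" using y x by simp
      obtain N where N: "maximum_matching Q N" "y \<notin> \<Union>N" using Q_missed[of y] Q_max yK KQ by blast
      define N' where "N' = {e \<in> N. e \<subseteq> reachable R `` {x}}"
      have "matching G N"
        using N(1) by (simp add: maximum_matching_def Q_def matching_delete_verts_iff[OF G])
      then have "matching G N'" by (rule matching_subset) (simp add: N'_def)
      moreover have "perfect_matching (delete_verts C {y}) N'"
        unfolding N'_def x(2) by (rule pm[OF x(1) refl yK N])
      ultimately show ?thesis by blast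
    qed
    have xC: "x \<in> verts C" using x reachable_self[of x R] QR by simp
    obtain N where N: "perfect_matching (delete_verts C {x}) N" "matching G N" using P[OF xC] by blast
    have "card (verts C - {x}) = 2 * card N"
      using matching_card_Union[OF G N(2)] N(1) by (simp add: perfect_matching_def)
    moreover have "finite (verts C)"
      using x(2) KQ simple_graph_finite(1)[OF Q] finite_subset by auto
    ultimately have "card (verts C) = Suc (2 * card N)" using xC by (metis card_Suc_Diff1)
    then show ?thesis unfolding factor_critical_def using P by auto
  qed

  \<comment> \<open>The d vertices missed by one maximum matching correspond to the components: two
    in the same component contradict \<open>conn\<close>, and an odd component always contains
    one.\<close>
  have "card Cs = d"
  proof -
    have "verts Q \<noteq> {}" using cQ size by auto
    then obtain N where N: "matching Q N" "2 * card N + d = card (verts Q)" using Q_missed by blast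
    then have Nmax: "maximum_matching Q N" using Q_max by simp
    have NR: "matching R N" using N(1) by (auto simp: matching_def Q_def R_def)
    define U where "U = verts Q - \<Union>N"
    define comp where "comp x = induced_subgraph R (reachable R `` {x})" for x
    have "inj_on comp U"
    proof (rule inj_onI)
      fix x y assume xy: "x \<in> U" "y \<in> U" "comp x = comp y"
      have "reachable R `` {x} = reachable R `` {y}"
        using arg_cong[OF xy(3), of verts] by (simp add: comp_def)
      moreover have "(y, y) \<in> reachable R" using xy(2) QR reachable_self[of y R] by (simp add: U_def)
      ultimately have "(x, y) \<in> reachable R" by blast
      then have "never_both_missed Q x y" using conn[of x y] xy(1) by (auto simp: reachable_def U_def)
      then show "x = y" using xy Nmax by (auto simp: never_both_missed_def U_def)
    qed
    moreover have "comp ` U = Cs"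
    proof (intro equalityI subsetI)
      fix C assume "C \<in> comp ` U"
      then show "C \<in> Cs" using in_Cs by (auto simp: comp_def U_def)
    next
      fix C assume C: "C \<in> Cs"
      obtain x where x: "x \<in> verts Q" "C = comp x" using class_Q[OF C] by (auto simp: comp_def)
      have "\<exists>y\<in>verts C. y \<notin> \<Union>N"
      proof (rule odd_set_missed[OF R NR])
        show "odd (card (verts C))" using fc[OF C] by simp
        fix e assume e: "e \<in> N" "e \<inter> verts C \<noteq> {}"
        have "e \<in> edges R" using e(1) NR by (auto simp: matching_def)
        then show "e \<subseteq> verts C" using edge_subset_class[OF R] e(2) x(2) by (auto simp: comp_def)
      qed
      then obtain y where y: "y \<in> verts C" "y \<notin> \<Union>N" by blast
      then have xy: "(x, y) \<in> reachable R" using x by (simp add: comp_def)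
      then have "y \<in> U" using conn[OF x(1)] y by (auto simp: reachable_def U_def)
      moreover have "comp y = C"
        using equiv_class_eq[OF equiv_reachable xy] x(2) by (simp add: comp_def)
      ultimately show "C \<in> comp ` U" by blast
    qed
    ultimately have "card Cs = card U" using card_image by metis
    also have "\<dots> = d"
    proof -
      have NQ: "\<Union>N \<subseteq> verts Q" using matching_Union_subset[OF Q N(1)] .
      then have "finite (\<Union>N)" using simple_graph_finite(1)[OF Q] finite_subset by blast
      then show ?thesis
        unfolding U_def using card_Diff_subset[OF _ NQ] matching_card_Union[OF Q N(1)] N(2) by simp
    qed
    finally show ?thesis .
  qed
  moreover have "k_matching m (induced_subgraph G S) M"
    using Mm cM by (auto simp: k_matching_def matching_def induced_subgraph_def S_def)
  ultimately show ?thesis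
    using SV cS single fc unfolding Cs_def R_def by blast
qed

section \<open>The equivalence\<close>

theorem theorem4p3:
  fixes G :: "'a graph" and n k d :: nat and u v :: 'a
  assumes "simple_graph G"
    and "k \<ge> 1"
    and "nkd_graph n k d G"
    and "{u, v} \<in> edges G"
    and "max (degree G u) (degree G v) \<ge> 2 * k"
  shows "\<not> nkd_graph n (k - 1) d (delete_edge G {u, v}) \<longleftrightarrow>
    (\<exists>S. S \<subseteq> verts G \<and> card S = n + 2 * k - 2 \<and>
      (\<exists>M. k_matching (k - 1) (induced_subgraph G S) M) \<and>
      single_edge u v \<in> components (delete_verts G S) \<and>
      card (components (delete_verts G S) - {single_edge u v}) = d \<and>
      (\<forall>C \<in> components (delete_verts G S) - {single_edge u v}.
         odd (card (verts C)) \<and> factor_critical C))"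
    (is "?L \<longleftrightarrow> (\<exists>S. ?W S)")
proof -
  \<comment> \<open>With this substitution \<open>n + 2 * k - 2\<close> is \<open>n + 2 * m\<close>,
    so the subtraction is never truncated.\<close>
  obtain m where k: "k = Suc m" using assms(2) by (cases k) auto
  have uv: "u \<noteq> v" using simple_graph_edgeD(2)[OF assms(1,4)] by auto
  have sym: "single_edge v u = single_edge u v" by (auto simp: single_edge_def)
  show ?thesis
  proof
    assume L: ?L
    consider "degree G u \<ge> 2 * Suc m" | "degree G v \<ge> 2 * Suc m"
      using assms(5) k by (auto simp: max_def split: if_splits)
    then show "\<exists>S. ?W S"
    proof cases
      case 1
      show ?thesis
        using nkd_graph_delete_edge_witness[OF assms(1) _ assms(4) 1, of n d] assms(3) L k by simp
    next
      \<comment> \<open>The edge and its component are symmetric in u and v, so the roles can be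
        swapped.\<close>
      case 2
      show ?thesis
        using nkd_graph_delete_edge_witness[OF assms(1) _ _ 2, of n d u] assms(3,4) L k sym
        by (simp add: insert_commute)
    qed
  next
    assume "\<exists>S. ?W S"
    then obtain S M where "S \<subseteq> verts G" "card S = n + 2 * m"
      "k_matching m (induced_subgraph G S) M"
      "single_edge u v \<in> components (delete_verts G S)"
      "card (components (delete_verts G S) - {single_edge u v}) = d"
      "\<forall>C \<in> components (delete_verts G S) - {single_edge u v}. odd (card (verts C))"
      using k by auto
    then show ?L using not_nkd_graph_delete_edge[OF assms(1) uv] k by simp
  qed
qed

end
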